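(* Fix a positive integer $n>1$, and let $f\in\mathcal{R}$ be an eigenfunction of $U_n$. If $U_n f(x)=\lambda f(x)$ for a nonzero eigenvalue $\lambda$, then $$\lambda=\omega\, n^{\kappa-1},\qquad\text{where}\qquad \omega:=e^{\frac{2\pi i m}{c}},$$ for some integer $m$. Here $\kappa$ is the weight of $f$, $L$ is the level of $f$, and $c:=\mathrm{ord}_L(n)$.
   Context: $\mathcal{R}$ is the complex vector space of rational functions $p(x)/q(x)$, $p,q\in\mathbb{C}[x]$, that are analytic at the origin; each is identified with its Taylor series $\sum_{k\ge 0}a(k)x^k$ near $0$. For a positive integer $n$, $U_n:\mathcal{R}\to\mathcal{R}$ is the linear operator $U_n\left(\sum_{k\ge 0}a(k)x^k\right)=\sum_{k\ge 0}a(nk)x^k$. For an eigenfunction $f\in\mathcal{R}$ of $U_n$ ($n>1$) with nonzero eigenvalue, all poles of $f$ are roots of unity, and the level of $f$ is the least positive integer $L$ such that all poles of $f$ are $L$-th roots of unity; moreover $\gcd(n,L)=1$. All poles of such an $f$ have the same multiplicity, and this common multiplicity, a unique nonnegative integer $\kappa$, is called the weight of $f$. $\mathrm{ord}_L(n)$ denotes the multiplicative order of $n$ modulo $L$.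
   Formalization: The formal theorem also assumes that f has at least one pole. This excludes only nonzero constants (eigenvalue 1), for which the weight is not uniquely defined and the convention weight 0 would make the formula false. *)

theory Defs
  imports "HOL-Complex_Analysis.Complex_Analysis" "HOL-Number_Theory.Number_Theory"
begin

text \<open>
  A rational function is represented as a total function in lowest terms. Coprimality of numerator
  and denominator removes removable singularities, at which \<open>p x / q x\<close> would be
  the junk value \<open>0 / 0 = 0\<close>; hence a rational function is analytic exactly away
  from its poles, and distinct fractions give distinct functions.
\<close>

definition is_rational_function :: "(complex \<Rightarrow> complex) \<Rightarrow> bool" where
  "is_rational_function g \<longleftrightarrow>
     (\<exists>p q :: complex poly. q \<noteq> 0 \<and> coprime p q \<and> g = (\<lambda>x. poly p x / poly q x))"

text \<open>Elements of the space are identified with their Taylor series at the origin.\<close>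

definition rational_series :: "complex fps set" where
  "rational_series =
     {f. \<exists>g. is_rational_function g \<and> g analytic_on {0} \<and> g has_fps_expansion f}"

text \<open>The rational function with a given Taylor series; it is unique by the remark above.\<close>

definition rational_function_of :: "complex fps \<Rightarrow> complex \<Rightarrow> complex" where
  "rational_function_of f = (THE g. is_rational_function g \<and> g has_fps_expansion f)"

definition U :: "nat \<Rightarrow> complex fps \<Rightarrow> complex fps" where
  "U n f = Abs_fps (\<lambda>k. fps_nth f (n * k))"

definition is_eigenfunction :: "nat \<Rightarrow> complex \<Rightarrow> complex fps \<Rightarrow> bool" where
  "is_eigenfunction n lam f \<longleftrightarrow> f \<in> rational_series \<and> f \<noteq> 0 \<and> U n f = fps_const lam * f"

definition poles :: "complex fps \<Rightarrow> complex set" where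
  "poles f = {z. is_pole (rational_function_of f) z}"

text \<open>A pole of multiplicity \<open>m\<close> is a point where the order \<^const>\<open>zorder\<close> is \<open>- m\<close>.\<close>

definition pole_multiplicity :: "complex fps \<Rightarrow> complex \<Rightarrow> nat" where
  "pole_multiplicity f z = nat (- zorder (rational_function_of f) z)"

definition level :: "complex fps \<Rightarrow> nat" where
  "level f = (LEAST L. L > 0 \<and> (\<forall>z\<in>poles f. z ^ L = 1))"

text \<open>
  The weight is only meaningful if \<open>f\<close> has a pole and all poles have the same multiplicity;
  for a pole-free \<open>f\<close> the description is not unique.
\<close>

definition weight :: "complex fps \<Rightarrow> nat" where
  "weight f = (THE \<kappa>. \<forall>z\<in>poles f. pole_multiplicity f z = \<kappa>)"

end

theory Submission
  imports Defs
begin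

text \<open>
  Write \<open>g\<close> for the rational function with Taylor series \<open>f\<close>. Averaging over the
  \<open>n\<close>-th roots of unity keeps only the coefficients whose index is divisible by
  \<open>n\<close>, so \<open>U n f = fps_const lam * f\<close> says that
  \<open>(\<Sum>\<zeta> | \<zeta> ^ n = 1. g (\<zeta> * y)) = n * lam * g (y ^ n)\<close>. This holds near the origin by
  comparison of power series and then, by analytic continuation, off a finite set
  (\<open>rational_eigenfunction_averaging\<close>). The theorem is read off from the singularities of the
  two sides.

  If \<open>z\<close> is a pole and \<open>y ^ n = z\<close>, the right-hand side is singular at \<open>y\<close>, hence so is
  some summand on the left: some \<open>\<zeta> * y\<close> is a pole, and its \<open>n\<close>-th power is \<open>z\<close>. So
  \<open>w \<mapsto> w ^ n\<close> maps a subset of the finite set of poles onto all of it, and therefore permutes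
  the poles. In particular every pole \<open>w\<close> satisfies \<open>w ^ (n ^ j) = w\<close> for a common
  \<open>j > 0\<close> and is a root of unity of order prime to \<open>n\<close>.

  By injectivity, only the summand \<open>\<zeta> = 1\<close> is singular at a pole \<open>w\<close>. Comparing the
  leading terms of \<open>g y\<close> and \<open>n * lam * g (y ^ n)\<close> in the local parameter
  \<open>y / w - 1\<close>, and using that \<open>y ^ n / w ^ n - 1\<close> is asymptotically \<open>n\<close> times this parameter,
  shows that \<open>w\<close> and \<open>w ^ n\<close> have the same multiplicity \<open>m\<close> and that their leading
  coefficients differ by the factor \<open>n * lam / n ^ m\<close> (\<open>leading_coeff_power\<close>). Going once around a
  cycle of poles, the leading coefficient returns to its nonzero value, so this factor is a root of
  unity. Taking absolute values, \<open>n * norm lam = n ^ m\<close>, which forces all cycles to have the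
  same \<open>m\<close>: this is the weight. Finally, let \<open>c\<close> be the
  multiplicative order of \<open>n\<close> modulo the level. Then \<open>c\<close> steps of the power map lead each pole
  back to itself, so the factor is a root of unity of order dividing \<open>c\<close>.
\<close>

section \<open>Rational functions and their poles\<close>

lemma coprime_polys_no_common_root:
  fixes p q :: "'a :: field poly"
  assumes "coprime p q" "poly q z = 0"
  shows "poly p z \<noteq> 0"
proof
  assume "poly p z = 0"
  hence "[:-z, 1:] dvd p" "[:-z, 1:] dvd q"
    using assms(2) by (simp_all add: poly_eq_0_iff_dvd)
  hence "is_unit [:-z, 1:]"
    using assms(1) coprime_common_divisor by blast
  thus False
    by (simp add: is_unit_iff_degree)
qed

lemma eventually_at_notin_finite:
  "finite A \<Longrightarrow> eventually (\<lambda>x. x \<notin> A) (at (z :: 'a :: t1_space))"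
  using islimpt_finite islimpt_iff_eventually by blast

text \<open>
  Cross-multiplying turns the identity of germs into an identity of polynomials. Coprimality then
  forces the two denominators to have the same zeros, so that the functions also agree there, where
  both take the value \<open>0\<close>.
\<close>

lemma rational_function_determined_by_germ:
  assumes "is_rational_function g" "is_rational_function h"
    and "eventually (\<lambda>x. g x = h x) (nhds 0)"
  shows "g = h"
proof -
  obtain p q where pq: "q \<noteq> 0" "coprime p q" "g = (\<lambda>x. poly p x / poly q x)"
    using assms(1) unfolding is_rational_function_def by blast
  obtain r s where rs: "s \<noteq> 0" "coprime r s" "h = (\<lambda>x. poly r x / poly s x)"
    using assms(2) unfolding is_rational_function_def by blast
  have "eventually (\<lambda>x. poly q x \<noteq> 0) (at 0)" "eventually (\<lambda>x. poly s x \<noteq> 0) (at 0)"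
    using eventually_at_notin_finite[OF poly_roots_finite] pq(1) rs(1) by force+
  moreover have "eventually (\<lambda>x. g x = h x) (at 0)"
    using assms(3) by (simp add: eventually_at_filter eventually_mono)
  ultimately have "eventually (\<lambda>x. poly (p * s - r * q) x = 0) (at 0)"
    by eventually_elim (auto simp: pq rs field_simps)
  moreover have "eventually (\<lambda>x. poly (p * s - r * q) x \<noteq> 0) (at 0)" if "p * s - r * q \<noteq> 0"
    using eventually_at_notin_finite[OF poly_roots_finite[OF that]] by simp
  ultimately have "p * s - r * q = 0"
    using eventually_happens'[OF trivial_limit_at] eventually_conj by fastforce
  hence eq: "p * s = r * q" by simp
  have cross: "poly p x * poly s x = poly r x * poly q x" for x
    using arg_cong[OF eq, of "\<lambda>t. poly t x"] by simp
  have zeros: "poly q x = 0 \<longleftrightarrow> poly s x = 0" for x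
    using cross[of x] coprime_polys_no_common_root[OF pq(2), of x]
      coprime_polys_no_common_root[OF rs(2), of x] by auto
  show ?thesis
  proof
    fix x
    show "g x = h x"
      using cross[of x] zeros[of x] by (auto simp: pq rs field_simps)
  qed
qed

lemma rational_function_of_eqI:
  assumes "is_rational_function g" "g has_fps_expansion f"
  shows "rational_function_of f = g"
  unfolding rational_function_of_def
proof (rule the_equality)
  fix h assume h: "is_rational_function h \<and> h has_fps_expansion f"
  have "eventually (\<lambda>x. h x = g x) (nhds 0)"
    using h assms(2) unfolding has_fps_expansion_def
    by (auto elim: eventually_elim2)
  thus "h = g"
    using h assms(1) rational_function_determined_by_germ by blast
qed (use assms in auto)

text \<open>
  The multiplicative normalisation \<open>y / w - 1\<close> of the local parameter at \<open>w \<noteq> 0\<close> is adapted to the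
  power map: pulling back along \<open>y \<mapsto> y ^ n\<close> rescales it by \<open>n\<close>, independently of \<open>w\<close>.
\<close>

definition has_leading_coeff :: "(complex \<Rightarrow> complex) \<Rightarrow> complex \<Rightarrow> nat \<Rightarrow> complex \<Rightarrow> bool" where
  "has_leading_coeff g w m D \<longleftrightarrow>
     m > 0 \<and> D \<noteq> 0 \<and> ((\<lambda>y. g y * (y / w - 1) ^ m) \<longlongrightarrow> D) (at w)"

lemma rational_function_at_root_of_denominator:
  fixes p q :: "complex poly"
  assumes "q \<noteq> 0" "coprime p q" "poly q w = 0"
  defines "g \<equiv> \<lambda>x. poly p x / poly q x"
  shows "is_pole g w" "zorder g w = - int (Polynomial.order w q)"
    "w \<noteq> 0 \<Longrightarrow> \<exists>D. has_leading_coeff g w (Polynomial.order w q) D"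
proof -
  define m where "m = Polynomial.order w q"
  have m: "m > 0"
    using assms by (simp add: m_def order_root)
  obtain r where r: "q = [:-w, 1:] ^ m * r" "\<not> [:-w, 1:] dvd r"
    using order_decomp[OF assms(1)] m_def by blast
  have rw: "poly r w \<noteq> 0" using r(2) by (simp add: poly_eq_0_iff_dvd)
  have pw: "poly p w \<noteq> 0" using coprime_polys_no_common_root assms by blast
  define h where "h = (\<lambda>x. poly p x / poly r x)"
  define A where "A = - {x. poly r x = 0}"
  have "r \<noteq> 0" using rw by auto
  hence A: "open A" unfolding A_def
    by (intro open_Compl finite_imp_closed poly_roots_finite)
  have wA: "w \<in> A" using rw by (simp add: A_def)
  have h: "h holomorphic_on A" unfolding h_def A_def
    by (intro holomorphic_intros) auto
  have hw: "h w \<noteq> 0" using rw pw by (simp add: h_def)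
  have g: "g x = h x / (x - w) ^ m" for x
    unfolding g_def h_def by (simp add: r(1))
  show "is_pole g w"
    using is_pole_basic[OF h A wA hw m] by (simp add: g[abs_def])
  show "zorder g w = - int (Polynomial.order w q)"
    by (rule zorder_eqI[OF A wA h hw])
       (simp add: g m_def power_int_minus divide_inverse)
  assume w0: "w \<noteq> 0"
  have "isCont h w"
    using h A wA holomorphic_on_imp_continuous_on continuous_on_eq_continuous_at by blast
  hence lim: "((\<lambda>y. h y / w ^ m) \<longlongrightarrow> h w / w ^ m) (at w)"
    using w0 by (auto simp: isCont_def intro!: tendsto_intros)
  have "((\<lambda>y. g y * (y / w - 1) ^ m) \<longlongrightarrow> h w / w ^ m) (at w)"
  proof (rule Lim_transform_eventually[OF lim])
    show "eventually (\<lambda>y. h y / w ^ m = g y * (y / w - 1) ^ m) (at w)"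
      unfolding eventually_at_filter
    proof (intro always_eventually allI impI)
      fix y assume "y \<noteq> w"
      have "y / w - 1 = (y - w) / w" using w0 by (simp add: field_simps)
      thus "h y / w ^ m = g y * (y / w - 1) ^ m"
        using \<open>y \<noteq> w\<close> by (simp add: g power_divide)
    qed
  qed
  moreover have "h w / w ^ m \<noteq> 0" using hw w0 by simp
  ultimately show "\<exists>D. has_leading_coeff g w (Polynomial.order w q) D"
    using m unfolding has_leading_coeff_def m_def[symmetric] by blast
qed

section \<open>Averaging over the roots of unity\<close>

text \<open>
  The set of roots of unity is invariant under multiplication by a primitive one, which multiplies
  the sum by its \<open>k\<close>-th power, a number different from \<open>1\<close> unless \<open>n dvd k\<close>.
\<close>

lemma sum_roots_unity_power:
  assumes "n > 0"
  shows "(\<Sum>\<zeta>::complex | \<zeta> ^ n = 1. \<zeta> ^ k) = (if n dvd k then of_nat n else 0)"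
proof (cases "n dvd k")
  case True
  then obtain j where "k = n * j" by auto
  hence "(\<Sum>\<zeta>::complex | \<zeta> ^ n = 1. \<zeta> ^ k) = (\<Sum>\<zeta>::complex | \<zeta> ^ n = 1. 1)"
    by (intro sum.cong) (auto simp: power_mult)
  thus ?thesis using True assms card_roots_unity_eq[of n] by simp
next
  case False
  define \<omega> where "\<omega> = exp (2 * of_real pi * \<i> * of_nat 1 / of_nat n)"
  have \<omega>n: "\<omega> ^ n = 1"
    unfolding \<omega>_def using complex_root_unity[of n 1] assms by simp
  hence "\<omega> \<noteq> 0" using assms by (auto simp: power_0_left)
  have "\<omega> ^ k = exp (2 * of_real pi * \<i> * of_nat k / of_nat n)"
    unfolding \<omega>_def exp_of_nat_mult[symmetric] by (simp add: field_simps)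
  hence \<omega>k: "\<omega> ^ k \<noteq> 1"
    using complex_root_unity_eq_1[of n k] assms False by simp
  have "bij_betw ((*) \<omega>) {\<zeta>. \<zeta> ^ n = 1} {\<zeta>. \<zeta> ^ n = 1}"
    by (rule bij_betwI[where g = "\<lambda>\<zeta>. \<zeta> / \<omega>"])
       (use \<omega>n \<open>\<omega> \<noteq> 0\<close> in \<open>auto simp: power_mult_distrib power_divide\<close>)
  hence "(\<Sum>\<zeta> | \<zeta> ^ n = 1. (\<omega> * \<zeta>) ^ k) = (\<Sum>\<zeta> | \<zeta> ^ n = 1. \<zeta> ^ k)"
    by (rule sum.reindex_bij_betw)
  hence "\<omega> ^ k * (\<Sum>\<zeta> | \<zeta> ^ n = 1. \<zeta> ^ k) = (\<Sum>\<zeta> | \<zeta> ^ n = 1. \<zeta> ^ k)"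
    by (simp add: power_mult_distrib sum_distrib_left)
  hence "(\<omega> ^ k - 1) * (\<Sum>\<zeta> | \<zeta> ^ n = 1. \<zeta> ^ k) = 0"
    by (simp add: left_diff_distrib)
  thus ?thesis using \<omega>k False by simp
qed

text \<open>
  The operator \<open>U n\<close> in analytic form: averaging \<open>g\<close> over rotations by \<open>n\<close>-th roots of unity
  annihilates the coefficients whose index is not a multiple of \<open>n\<close> and multiplies the others by \<open>n\<close>.
\<close>

lemma has_fps_expansion_averaging:
  assumes "n > 0" "g has_fps_expansion f" "h has_fps_expansion U n f"
  shows "(\<lambda>y. (\<Sum>\<zeta> | \<zeta> ^ n = 1. g (\<zeta> * y)) - of_nat n * h (y ^ n)) has_fps_expansion 0"
proof -
  have lin: "(\<lambda>y. g (\<zeta> * y)) has_fps_expansion (f oo (fps_const \<zeta> * fps_X))" for \<zeta>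
  proof -
    have "(\<lambda>y. \<zeta> * y) has_fps_expansion fps_const \<zeta> * fps_X"
      by (intro fps_expansion_intros)
    from has_fps_expansion_compose[OF assms(2) this] show ?thesis by (simp add: o_def)
  qed
  have pow: "(\<lambda>y. h (y ^ n)) has_fps_expansion (U n f oo (fps_X ^ n))"
    using has_fps_expansion_compose[OF assms(3) has_fps_expansion_fps_X_power[of n]] assms(1)
    by (simp add: o_def)
  have "(\<lambda>y. (\<Sum>\<zeta> | \<zeta> ^ n = 1. g (\<zeta> * y)) - of_nat n * h (y ^ n)) has_fps_expansion
          ((\<Sum>\<zeta> | \<zeta> ^ n = 1. f oo (fps_const \<zeta> * fps_X))
            - fps_const (of_nat n) * (U n f oo (fps_X ^ n)))"
    by (intro has_fps_expansion_diff has_fps_expansion_sum has_fps_expansion_cmult_left lin pow)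
  also have "\<dots> = 0"
  proof (rule fps_ext)
    fix k
    have "fps_nth (\<Sum>\<zeta> | \<zeta> ^ n = 1. f oo (fps_const \<zeta> * fps_X)) k
            = (\<Sum>\<zeta>::complex | \<zeta> ^ n = 1. \<zeta> ^ k) * fps_nth f k"
      by (simp add: fps_sum_nth fps_compose_linear sum_distrib_right)
    thus "fps_nth ((\<Sum>\<zeta> | \<zeta> ^ n = 1. f oo (fps_const \<zeta> * fps_X))
            - fps_const (of_nat n) * (U n f oo (fps_X ^ n))) k = fps_nth 0 k"
      using assms(1) by (auto simp: fps_nth_compose_X_power sum_roots_unity_power U_def)
  qed
  finally show ?thesis .
qed

text \<open>
  The complement of the finitely many singularities is connected, so the identity spreads from the
  origin to all of it. The eventual form is what the limits at a pole need: a punctured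
  neighbourhood of any point avoids the finite exceptional set.
\<close>

lemma rational_eigenfunction_averaging:
  fixes p q :: "complex poly"
  assumes "n > 0" "q \<noteq> 0" "poly q 0 \<noteq> 0"
  defines "g \<equiv> \<lambda>x. poly p x / poly q x"
  assumes "g has_fps_expansion f" "U n f = fps_const lam * f"
  shows "eventually (\<lambda>y. (\<Sum>\<zeta> | \<zeta> ^ n = 1. g (\<zeta> * y)) = of_nat n * (lam * g (y ^ n))) (at z)"
proof -
  define d where "d = (\<lambda>y. (\<Sum>\<zeta> | \<zeta> ^ n = 1. g (\<zeta> * y)) - of_nat n * (lam * g (y ^ n)))"
  define A where "A = {y. poly q (y ^ n) = 0} \<union> (\<Union>\<zeta>\<in>{\<zeta>. \<zeta> ^ n = 1}. {y. poly q (\<zeta> * y) = 0})"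
  have "(\<lambda>x. lam * g x) has_fps_expansion U n f"
    unfolding assms(6) by (intro has_fps_expansion_cmult_left assms)
  hence d0: "d has_fps_expansion 0"
    unfolding d_def by (rule has_fps_expansion_averaging[OF assms(1,5)])
  have "finite {y. poly q (y ^ n) = 0}"
  proof -
    have "{y. poly q (y ^ n) = 0} = (\<Union>x\<in>{x. poly q x = 0}. {y. y ^ n = x})" by auto
    thus ?thesis using poly_roots_finite[OF assms(2)] finite_nth_roots[OF assms(1)] by simp
  qed
  moreover have "finite {y. poly q (\<zeta> * y) = 0}" if "\<zeta> ^ n = 1" for \<zeta>
  proof -
    have "\<zeta> \<noteq> 0" using that assms(1) by (auto simp: power_0_left)
    hence "{y. poly q (\<zeta> * y) = 0} \<subseteq> (\<lambda>x. x / \<zeta>) ` {x. poly q x = 0}"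
      by (auto intro!: image_eqI)
    thus ?thesis using poly_roots_finite[OF assms(2)] finite_surj by blast
  qed
  ultimately have A: "finite A"
    using finite_roots_unity[of n, where ?'a = complex] assms(1) unfolding A_def by auto
  have op: "open (UNIV - A)"
    using A by (intro open_Diff finite_imp_closed) auto
  have conn: "connected (UNIV - A)"
    using A by (intro connected_open_delete_finite) auto
  have "0 \<in> UNIV - A"
    using assms(1,3) by (auto simp: A_def power_0_left)
  moreover have "d holomorphic_on UNIV - A"
    unfolding d_def g_def by (intro holomorphic_intros) (auto simp: A_def)
  ultimately have "d y = 0" if "y \<in> UNIV - A" for y
    using has_fps_expansion_0_analytic_continuation[OF d0 _ op conn] that by blast
  moreover have "eventually (\<lambda>y. y \<notin> A) (at z)"
    using A by (rule eventually_at_notin_finite)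
  ultimately show ?thesis
    unfolding d_def by (auto elim!: eventually_mono)
qed

section \<open>The power map on the poles\<close>

lemma leading_coeff_unique:
  assumes "((\<lambda>y. h y * u y ^ a) \<longlongrightarrow> A) F" "((\<lambda>y. h y * u y ^ b) \<longlongrightarrow> B) F"
    and "(u \<longlongrightarrow> 0) F" "F \<noteq> bot" "A \<noteq> 0" "(B :: 'a :: real_normed_field) \<noteq> 0"
  shows "a = b \<and> A = B"
proof -
  have aux: "\<not> a < b"
    if "((\<lambda>y. h y * u y ^ a) \<longlongrightarrow> A) F" "((\<lambda>y. h y * u y ^ b) \<longlongrightarrow> B) F" "B \<noteq> 0"
    for a b and A B :: 'a
  proof
    assume "a < b"
    have "((\<lambda>y. h y * u y ^ a * u y ^ (b - a)) \<longlongrightarrow> A * 0 ^ (b - a)) F"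
      by (intro tendsto_intros that assms)
    hence "((\<lambda>y. h y * u y ^ b) \<longlongrightarrow> 0) F"
      using \<open>a < b\<close> by (simp add: mult.assoc power_add[symmetric] power_0_left)
    thus False using tendsto_unique[OF assms(4) that(2)] that(3) by blast
  qed
  have "a = b" using aux[OF assms(1,2,6)] aux[OF assms(2,1,5)] by simp
  thus ?thesis using tendsto_unique[OF assms(4) assms(1)] assms(2) by blast
qed

text \<open>
  The power map is a local biholomorphism at \<open>w \<noteq> 0\<close>, so it preserves the multiplicity of a pole; its
  derivative in the multiplicative parameter is \<open>n\<close>.
\<close>

lemma has_leading_coeff_power_map:
  assumes "has_leading_coeff g (w ^ n) m D" "w \<noteq> 0" "n > 0"
  shows "has_leading_coeff (\<lambda>y. g (y ^ n)) w m (D / of_nat n ^ m)"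
proof -
  have m: "m > 0" "D \<noteq> 0" and lim: "((\<lambda>x. g x * (x / w ^ n - 1) ^ m) \<longlongrightarrow> D) (at (w ^ n))"
    using assms(1) by (auto simp: has_leading_coeff_def)
  \<comment> \<open>The quotient of the two local parameters at \<open>w ^ n\<close> and at \<open>w\<close> is a geometric
    sum, which tends to \<open>n\<close>.\<close>
  define s where "s = (\<lambda>y. \<Sum>i<n. (y / w) ^ i)"
  have s: "(y / w - 1) * s y = y ^ n / w ^ n - 1" for y
    unfolding s_def power_divide[symmetric] by (rule power_diff_1_eq[symmetric])
  have "(s \<longlongrightarrow> (\<Sum>i<n. (w / w) ^ i)) (at w)"
    unfolding s_def using assms(2) by (intro tendsto_intros)
  hence slim: "(s \<longlongrightarrow> of_nat n) (at w)" using assms(2) by simp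
  have ev: "eventually (\<lambda>y. s y \<noteq> 0) (at w)"
    using tendsto_imp_eventually_ne[OF slim] assms(3) by simp
  have ne: "eventually (\<lambda>y. y \<noteq> w) (at w)" by (simp add: eventually_at_filter)
  have "eventually (\<lambda>y. y ^ n \<noteq> w ^ n) (at w)"
    using ev ne
  proof eventually_elim
    case (elim y)
    hence "(y / w - 1) * s y \<noteq> 0" using assms(2) by auto
    thus ?case using s[of y] assms(2) by auto
  qed
  moreover have "((\<lambda>y. y ^ n) \<longlongrightarrow> w ^ n) (at w)" by (intro tendsto_intros)
  ultimately have "filterlim (\<lambda>y. y ^ n) (at (w ^ n)) (at w)"
    by (simp add: filterlim_at)
  from filterlim_compose[OF lim this]
  have "((\<lambda>y. g (y ^ n) * (y ^ n / w ^ n - 1) ^ m / s y ^ m) \<longlongrightarrow> D / of_nat n ^ m) (at w)"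
    using assms(3) by (intro tendsto_intros slim) auto
  moreover have "eventually (\<lambda>y. g (y ^ n) * (y ^ n / w ^ n - 1) ^ m / s y ^ m =
                    g (y ^ n) * (y / w - 1) ^ m) (at w)"
    using ev by eventually_elim (simp add: s[symmetric] power_mult_distrib)
  ultimately have "((\<lambda>y. g (y ^ n) * (y / w - 1) ^ m) \<longlongrightarrow> D / of_nat n ^ m) (at w)"
    by (rule Lim_transform_eventually)
  thus ?thesis using m assms(3) by (auto simp: has_leading_coeff_def)
qed

text \<open>
  All that the eigenvalue formula needs of an eigenfunction: the averaging identity and the
  local shape of \<open>g\<close> at its finite set \<open>S\<close> of poles.
\<close>

locale averaging_equation =
  fixes g :: "complex \<Rightarrow> complex" and S :: "complex set" and n :: nat and lam :: complex
    and m :: "complex \<Rightarrow> nat" and D :: "complex \<Rightarrow> complex"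
  assumes n: "n > 1" and lam: "lam \<noteq> 0"
    and finite_poles: "finite S" and zero_no_pole: "0 \<notin> S"
    and regular: "\<And>z. z \<notin> S \<Longrightarrow> isCont g z"
    and pole: "\<And>z. z \<in> S \<Longrightarrow> is_pole g z"
    and leading_coeff: "\<And>z. z \<in> S \<Longrightarrow> has_leading_coeff g z (m z) (D z)"
    and averaging:
      "\<And>z. eventually (\<lambda>y. (\<Sum>\<zeta> | \<zeta> ^ n = 1. g (\<zeta> * y)) = of_nat n * (lam * g (y ^ n))) (at z)"
begin

lemma summand_tendsto: "\<zeta> * y \<notin> S \<Longrightarrow> ((\<lambda>x. g (\<zeta> * x)) \<longlongrightarrow> g (\<zeta> * y)) (at y)"
  by (rule isCont_tendsto_compose[OF regular]) (auto intro!: tendsto_intros)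

text \<open>
  A pole \<open>z\<close> makes the right-hand side of the averaging identity singular at every \<open>n\<close>-th
  root of \<open>z\<close>; a sum of functions that are all continuous there could not match it.
\<close>

lemma poles_subset_power_image: "S \<subseteq> (\<lambda>w. w ^ n) ` S"
proof
  fix z assume z: "z \<in> S"
  hence "z \<noteq> 0" using zero_no_pole by auto
  hence "{y. y ^ n = z} \<noteq> {}"
    using card_nth_roots[of z n] n by force
  then obtain y where y: "y ^ n = z" by auto
  have "y \<noteq> 0" using y \<open>z \<noteq> 0\<close> n by (auto simp: power_0_left)
  have "\<exists>\<zeta>. \<zeta> ^ n = 1 \<and> \<zeta> * y \<in> S"
  proof (rule ccontr)
    assume "\<not> ?thesis"
    hence "((\<lambda>x. \<Sum>\<zeta> | \<zeta> ^ n = 1. g (\<zeta> * x)) \<longlongrightarrow> (\<Sum>\<zeta> | \<zeta> ^ n = 1. g (\<zeta> * y))) (at y)"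
      by (intro tendsto_sum summand_tendsto) auto
    hence lim: "((\<lambda>x. of_nat n * (lam * g (x ^ n))) \<longlongrightarrow> (\<Sum>\<zeta> | \<zeta> ^ n = 1. g (\<zeta> * y))) (at y)"
      using averaging by (rule Lim_transform_eventually)
    have "eventually (\<lambda>x. x \<notin> {x. x ^ n = z}) (at y)"
      using n by (intro eventually_at_notin_finite finite_nth_roots) simp
    hence "is_pole (\<lambda>x. g (x ^ n)) y"
      by (intro is_pole_compose[OF pole[OF z]]) (use y in \<open>auto intro!: tendsto_eq_intros\<close>)
    hence "is_pole (\<lambda>x. of_nat n * (lam * g (x ^ n))) y"
      using lam n by simp
    thus False
      using lim not_tendsto_and_filterlim_at_infinity[of "at y"] unfolding is_pole_def by auto
  qed
  then obtain \<zeta> where "\<zeta> ^ n = 1" "\<zeta> * y \<in> S" by auto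
  thus "z \<in> (\<lambda>w. w ^ n) ` S"
    using y by (intro image_eqI[of _ _ "\<zeta> * y"]) (auto simp: power_mult_distrib)
qed

lemma inj_on_power: "inj_on (\<lambda>w. w ^ n) S"
  by (rule finite_surj_inj[OF finite_poles poles_subset_power_image])

lemma power_closed: "w \<in> S \<Longrightarrow> w ^ n \<in> S"
  using card_seteq[OF _ poles_subset_power_image] card_image_le[OF finite_poles] finite_poles
  by blast

lemma iterated_power_closed: "w \<in> S \<Longrightarrow> w ^ (n ^ i) \<in> S"
  by (induction i) (auto simp: power_mult mult.commute[of n] power_closed)

text \<open>
  Since the power map is injective on the poles, every summand with \<open>\<zeta> \<noteq> 1\<close> is continuous at \<open>w\<close>
  and disappears after multiplication by a positive power of the local parameter. What remains is the
  leading term of \<open>g y\<close> at \<open>w\<close> against that of \<open>n * lam * g (y ^ n)\<close>.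
\<close>

lemma leading_coeff_power:
  assumes w: "w \<in> S"
  shows "m (w ^ n) = m w" "D w = of_nat n * lam / of_nat n ^ m w * D (w ^ n)"
proof -
  have "w \<noteq> 0" using w zero_no_pole by auto
  have wn: "w ^ n \<in> S" using w by (rule power_closed)
  define R where "R = {\<zeta>::complex. \<zeta> ^ n = 1}"
  have R: "finite R" "1 \<in> R"
    using finite_roots_unity[of n, where ?'a = complex] n by (auto simp: R_def)
  have other: "\<zeta> * w \<notin> S" if "\<zeta> \<in> R - {1}" for \<zeta>
  proof
    assume "\<zeta> * w \<in> S"
    moreover have "(\<zeta> * w) ^ n = w ^ n" using that by (simp add: R_def power_mult_distrib)
    ultimately have "\<zeta> * w = w" using inj_on_power w by (auto dest: inj_onD)
    thus False using that \<open>w \<noteq> 0\<close> by simp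
  qed
  define u where "u = (\<lambda>y. y / w - 1)"
  have u: "(u \<longlongrightarrow> 0) (at w)"
    unfolding u_def using \<open>w \<noteq> 0\<close> by (auto intro!: tendsto_eq_intros)
  have lw: "m w > 0" "D w \<noteq> 0" "((\<lambda>y. g y * u y ^ m w) \<longlongrightarrow> D w) (at w)"
    using leading_coeff[OF w] by (auto simp: has_leading_coeff_def u_def)
  have z0: "D w + (\<Sum>\<zeta>\<in>R - {1}. g (\<zeta> * w)) * 0 ^ m w = D w"
    using lw(1) by simp
  have "((\<lambda>y. g y * u y ^ m w + (\<Sum>\<zeta>\<in>R - {1}. g (\<zeta> * y)) * u y ^ m w)
          \<longlongrightarrow> D w + (\<Sum>\<zeta>\<in>R - {1}. g (\<zeta> * w)) * 0 ^ m w) (at w)"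
    by (intro tendsto_intros u lw summand_tendsto other)
  hence l0: "((\<lambda>y. g y * u y ^ m w + (\<Sum>\<zeta>\<in>R - {1}. g (\<zeta> * y)) * u y ^ m w) \<longlongrightarrow> D w) (at w)"
    unfolding z0 .
  have "eventually (\<lambda>y. g y * u y ^ m w + (\<Sum>\<zeta>\<in>R - {1}. g (\<zeta> * y)) * u y ^ m w =
                    of_nat n * lam * g (y ^ n) * u y ^ m w) (at w)"
    using averaging[of w]
  proof eventually_elim
    case (elim y)
    have "g y + (\<Sum>\<zeta>\<in>R - {1}. g (\<zeta> * y)) = of_nat n * lam * g (y ^ n)"
      using elim sum.remove[OF R, of "\<lambda>\<zeta>. g (\<zeta> * y)"] by (simp add: R_def mult.assoc)
    thus ?case by (metis distrib_right)
  qed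
  with l0 have l1: "((\<lambda>y. of_nat n * lam * g (y ^ n) * u y ^ m w) \<longlongrightarrow> D w) (at w)"
    by (rule Lim_transform_eventually)
  have l: "has_leading_coeff (\<lambda>y. g (y ^ n)) w (m (w ^ n)) (D (w ^ n) / of_nat n ^ m (w ^ n))"
    using has_leading_coeff_power_map[OF leading_coeff[OF wn]] \<open>w \<noteq> 0\<close> n by simp
  hence "((\<lambda>y. of_nat n * lam * (g (y ^ n) * u y ^ m (w ^ n)))
          \<longlongrightarrow> of_nat n * lam * (D (w ^ n) / of_nat n ^ m (w ^ n))) (at w)"
    unfolding u_def by (intro tendsto_intros) (auto simp: has_leading_coeff_def)
  hence l2: "((\<lambda>y. of_nat n * lam * g (y ^ n) * u y ^ m (w ^ n))
          \<longlongrightarrow> of_nat n * lam * (D (w ^ n) / of_nat n ^ m (w ^ n))) (at w)"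
    by (simp add: mult.assoc)
  have "of_nat n * lam * (D (w ^ n) / of_nat n ^ m (w ^ n)) \<noteq> 0"
    using l lam n by (auto simp: has_leading_coeff_def)
  from leading_coeff_unique[OF l2 l1 u _ this lw(2)]
  show "m (w ^ n) = m w" "D w = of_nat n * lam / of_nat n ^ m w * D (w ^ n)" by auto
qed

lemma leading_coeff_iterated_power:
  assumes "w \<in> S"
  shows "m (w ^ (n ^ i)) = m w \<and> D w = (of_nat n * lam / of_nat n ^ m w) ^ i * D (w ^ (n ^ i))"
proof (induction i)
  case (Suc i)
  have "w ^ (n ^ Suc i) = (w ^ (n ^ i)) ^ n" by (simp add: power_mult[symmetric] mult.commute)
  thus ?case
    using Suc leading_coeff_power[OF iterated_power_closed[OF assms, of i]] by simp
qed simp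

text \<open>
  A pole fixed by \<open>i\<close> steps of the power map gets back its own nonzero leading coefficient.
\<close>

lemma multiplier_power_eq_1:
  assumes "w \<in> S" "w ^ (n ^ i) = w"
  shows "(of_nat n * lam / of_nat n ^ m w) ^ i = 1"
  using leading_coeff_iterated_power[OF assms(1), of i] leading_coeff[OF assms(1)] assms(2)
  by (auto simp: has_leading_coeff_def)

text \<open>
  Only finitely many maps from the poles to themselves exist, so two iterates of the power map
  agree on the poles, and injectivity cancels the common part.
\<close>

lemma ex_common_period: "\<exists>j>0. \<forall>w\<in>S. w ^ (n ^ j) = w"
proof -
  define F where "F = (\<lambda>i. restrict (\<lambda>w. w ^ (n ^ i)) S)"
  have "range F \<subseteq> S \<rightarrow>\<^sub>E S" using iterated_power_closed by (auto simp: F_def)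
  hence "finite (range F)"
    using finite_PiE[OF finite_poles, of "\<lambda>_. S"] finite_poles finite_subset by blast
  hence "\<not> inj F" using finite_imageD infinite_UNIV_nat by blast
  then obtain a b where ab: "F a = F b" "a < b"
    by (metis injI linorder_neqE_nat)
  have inj: "inj_on (\<lambda>w. w ^ (n ^ i)) S" for i
  proof (induction i)
    case (Suc i)
    have "inj_on ((\<lambda>w. w ^ n) \<circ> (\<lambda>w. w ^ (n ^ i))) S"
      using Suc inj_on_power iterated_power_closed by (intro comp_inj_on) (auto intro: inj_on_subset)
    thus ?case by (simp add: o_def power_mult[symmetric] mult.commute)
  qed simp
  have "w ^ (n ^ (b - a)) = w" if "w \<in> S" for w
  proof -
    have "w ^ (n ^ a) = w ^ (n ^ b)" using ab(1) that by (metis F_def restrict_apply')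
    also have "n ^ b = n ^ (b - a) * n ^ a" using ab(2) by (simp add: power_add[symmetric])
    finally show ?thesis
      using inj[of a] that iterated_power_closed[OF that]
      by (metis inj_onD power_mult)
  qed
  thus ?thesis using ab(2) by (intro exI[of _ "b - a"]) auto
qed

text \<open>
  The factor picked up by the leading coefficient along one step has modulus \<open>1\<close>. Since
  the left-hand side does not mention \<open>w\<close>, this also shows that all poles have the same multiplicity.
\<close>

lemma norm_eigenvalue:
  assumes "w \<in> S"
  shows "real n * norm lam = real n ^ m w"
proof -
  obtain j where j: "j > 0" "\<forall>w\<in>S. w ^ (n ^ j) = w" using ex_common_period by blast
  have "(of_nat n * lam / of_nat n ^ m w) ^ j = 1"
    using multiplier_power_eq_1 assms j(2) by blast
  hence "norm (of_nat n * lam / of_nat n ^ m w) = 1"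
    using j(1) by (metis norm_ge_zero norm_one norm_power power_eq_1_iff less_irrefl)
  thus ?thesis using n by (simp add: norm_mult norm_divide norm_power)
qed

lemma multiplicity_constant: "w \<in> S \<Longrightarrow> z \<in> S \<Longrightarrow> m w = m z"
  using norm_eigenvalue[of w] norm_eigenvalue[of z] n by simp

end

section \<open>The level\<close>

text \<open>
  The exponents to which all elements of \<open>S\<close> have power \<open>1\<close> include \<open>n ^ j - 1\<close> and are
  closed under \<open>gcd\<close>, so the least one divides \<open>n ^ j - 1\<close> and is thereby prime to \<open>n\<close>. Hence \<open>ord L n\<close> is a genuine
  order and a common period of the power map on \<open>S\<close>.
\<close>

lemma level_periodic_points:
  fixes S :: "complex set"
  assumes "n > 1" "j > 0" "0 \<notin> S" "\<And>w. w \<in> S \<Longrightarrow> w ^ (n ^ j) = w"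
  defines "L \<equiv> LEAST L. L > 0 \<and> (\<forall>z\<in>S. z ^ L = 1)"
  shows "coprime L n" "\<And>w. w \<in> S \<Longrightarrow> w ^ (n ^ ord L n) = w"
proof -
  define P where "P = (\<lambda>L::nat. L > 0 \<and> (\<forall>z\<in>S. z ^ L = 1))"
  define M where "M = n ^ j - 1"
  have nj: "n ^ j > 1" using assms(1,2) by (rule one_less_power)
  have wM: "w ^ M = 1" if "w \<in> S" for w
  proof -
    have "w * w ^ M = w ^ Suc M" by simp
    also have "Suc M = n ^ j" using nj by (simp add: M_def)
    finally have "w * w ^ M = w" using assms(4)[OF that] by simp
    thus ?thesis using that assms(3) by auto
  qed
  have "P M" using nj wM by (auto simp: P_def M_def)
  hence PL: "P L" unfolding L_def P_def by (rule LeastI)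
  have "w ^ gcd L M = 1" if "w \<in> S" for w
  proof -
    obtain a b where "a * L = b * M + gcd L M"
      using bezout_nat[of L M] PL by (auto simp: P_def mult.commute)
    hence "w ^ (L * a) = w ^ (M * b) * w ^ gcd L M"
      by (simp add: mult.commute power_add)
    thus ?thesis using wM[OF that] PL that by (simp add: power_mult P_def)
  qed
  hence "P (gcd L M)" using PL by (auto simp: P_def)
  hence "L \<le> gcd L M" unfolding L_def P_def by (rule Least_le)
  hence "L dvd M" using PL by (metis P_def dvd_imp_le gcd_dvd1 gcd_dvd2 le_antisym)
  moreover have "coprime M n"
  proof -
    have "coprime M (n ^ j)"
      unfolding M_def using nj by (intro coprime_diff_one_left_nat) linarith
    thus ?thesis using assms(1,2) by simp
  qed
  ultimately show "coprime L n" by (metis coprime_divisors dvd_refl)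
  fix w assume w: "w \<in> S"
  have "[n ^ ord L n = 1] (mod L)" by (rule ord)
  then obtain k where "n ^ ord L n = 1 + L * k"
    using assms(1) by (metis cong_to_1'_nat mult.commute add.commute le_add1 cong_le_nat one_le_power less_imp_le)
  thus "w ^ (n ^ ord L n) = w" using PL w by (simp add: P_def power_add power_mult)
qed

lemma root_of_unity_eq_exp:
  assumes "(z::complex) ^ c = 1" "c > 0"
  shows "\<exists>k::int. z = exp (2 * of_real pi * \<i> * of_int k / of_nat c)"
proof -
  obtain k :: nat where "z = exp (2 * of_real pi * \<i> * of_nat k / of_nat c)"
    using assms complex_roots_unity[of c] by auto
  thus ?thesis by (intro exI[of _ "int k"]) simp
qed

section \<open>The eigenvalue\<close>

theorem theorem3:
  fixes n :: nat and f :: "complex fps" and lam :: complex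
  assumes "n > 1"
    and "is_eigenfunction n lam f"
    and "lam \<noteq> 0"
    and "poles f \<noteq> {}"
  shows "\<exists>m::int. lam = exp (2 * of_real pi * \<i> * of_int m / of_nat (ord (level f) n))
                      * of_nat n powi (int (weight f) - 1)"
proof -
  obtain g where g: "is_rational_function g" "g analytic_on {0}" "g has_fps_expansion f"
    and eig: "U n f = fps_const lam * f"
    using assms(2) by (auto simp: is_eigenfunction_def rational_series_def)
  obtain p q where pq: "q \<noteq> 0" "coprime p q" and g_eq: "g = (\<lambda>x. poly p x / poly q x)"
    using g(1) unfolding is_rational_function_def by blast
  have rf: "rational_function_of f = g" using rational_function_of_eqI g by blast
  have q0: "poly q 0 \<noteq> 0"
  proof
    assume "poly q 0 = 0"
    hence "is_pole (\<lambda>x. poly p x / poly q x) 0"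
      using rational_function_at_root_of_denominator(1)[OF pq] by blast
    thus False using g(2) analytic_at_imp_no_pole g_eq by blast
  qed
  define S where "S = {z. poly q z = 0}"
  define D where "D = (\<lambda>w. SOME D. has_leading_coeff g w (Polynomial.order w q) D)"
  interpret averaging_equation g S n lam "\<lambda>w. Polynomial.order w q" D
  proof
    show "n > 1" "lam \<noteq> 0" by fact+
    show "finite S" unfolding S_def using pq(1) by (rule poly_roots_finite)
    show "0 \<notin> S" using q0 by (simp add: S_def)
    show "isCont g z" if "z \<notin> S" for z
      using that unfolding g_eq S_def by (intro continuous_intros) auto
    fix z
    show "eventually (\<lambda>y. (\<Sum>\<zeta> | \<zeta> ^ n = 1. g (\<zeta> * y)) = of_nat n * (lam * g (y ^ n))) (at z)"
      using rational_eigenfunction_averaging[of n q p f lam z] assms(1) pq(1) q0 g(3) eig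
      unfolding g_eq by simp
    assume "z \<in> S"
    hence z: "poly q z = 0" "z \<noteq> 0" using q0 by (auto simp: S_def)
    show "is_pole g z" "has_leading_coeff g z (Polynomial.order z q) (D z)"
      using rational_function_at_root_of_denominator[OF pq z(1)] z(2) unfolding g_eq[symmetric] D_def
      by (auto intro: someI_ex)
  qed
  have poles: "poles f = S"
    using pole regular not_tendsto_and_filterlim_at_infinity[OF trivial_limit_at]
    unfolding poles_def rf is_pole_def isCont_def by blast
  have mult: "pole_multiplicity f w = Polynomial.order w q" if "w \<in> S" for w
  proof -
    have "poly q w = 0" "w \<noteq> 0" using that zero_no_pole by (auto simp: S_def)
    thus ?thesis
      unfolding pole_multiplicity_def rf g_eq
      by (simp add: rational_function_at_root_of_denominator(2)[OF pq])
  qed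
  obtain w where w: "w \<in> S" using assms(4) poles by auto
  have weight: "weight f = Polynomial.order w q"
    unfolding weight_def poles
  proof (rule the_equality)
    show "\<forall>z\<in>S. pole_multiplicity f z = Polynomial.order w q"
      using mult multiplicity_constant[OF _ w] by auto
  qed (use w mult in auto)
  define c where "c = ord (level f) n"
  obtain j where j: "j > 0" "\<forall>w\<in>S. w ^ (n ^ j) = w" using ex_common_period by blast
  have "coprime (level f) n" and per: "w ^ (n ^ c) = w"
    using level_periodic_points[OF assms(1) j(1) zero_no_pole] j(2) w
    unfolding c_def level_def poles by auto
  hence c: "c > 0" by (simp add: c_def)
  obtain k :: int where k: "of_nat n * lam / of_nat n ^ Polynomial.order w q
                              = exp (2 * of_real pi * \<i> * of_int k / of_nat c)"
    using root_of_unity_eq_exp[OF multiplier_power_eq_1[OF w per] c] by blast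
  have "lam = of_nat n * lam / of_nat n ^ Polynomial.order w q * of_nat n powi (int (Polynomial.order w q) - 1)"
    using assms(1) by (simp add: power_int_diff)
  thus ?thesis
    unfolding k weight c_def by blast
qed

end
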